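(* For each positive integer $d$, $r_d\colon\mathbb{N}^d\to\mathbb{N}$ is a $d$-tupling function (a bijection from $\mathbb{N}^d$ to $\mathbb{N}$), and its inverse is the function $r_d^{-1}\colon\mathbb{N}\to\mathbb{N}^d$ given by the recursive formula in the context.
   Context: $\mathbb{N}$ denotes the set of non-negative integers. The Rosenberg-Strong $d$-tupling function $r_d\colon\mathbb{N}^d\to\mathbb{N}$ is defined by $r_1(x_1)=x_1$ and, for $d>1$, $r_d(x_1,\ldots,x_{d-1},x_d)=r_{d-1}(x_1,\ldots,x_{d-1})+m^d+(m-x_d)\bigl((m+1)^{d-1}-m^{d-1}\bigr)$ with $m=\max(x_1,\ldots,x_d)$. The formula $r_d^{-1}$ is defined recursively by $r_1^{-1}(z)=z$ and, for integers $d>1$, $r_d^{-1}(z)=\Bigl(r_{d-1}^{-1}\bigl(z-m^d-(m-x_d)((m+1)^{d-1}-m^{d-1})\bigr),\,x_d\Bigr)$, where $m=\lfloor\sqrt[d]{z}\rfloor$ and $x_d=m-\left\lfloor\frac{\max(0,\,z-m^d-m^{d-1})}{(m+1)^{d-1}-m^{d-1}}\right\rfloor$; here $(\mathbf{v},x_d)$ with $\mathbf{v}=(v_1,\ldots,v_{d-1})$ denotes $(v_1,\ldots,v_{d-1},x_d)$. *)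

theory Defs
  imports Complex_Main
begin

definition tuples :: "nat \<Rightarrow> nat list set" where
  "tuples d = {xs. length xs = d}"

definition tupling_function :: "nat \<Rightarrow> (nat list \<Rightarrow> nat) \<Rightarrow> bool" where
  "tupling_function d f \<longleftrightarrow> bij_betw f (tuples d) UNIV"

text \<open>A tuple (x_1, ..., x_d) is the list of its components, so x_d is its last element.
  The subtractions on \<^typ>\<open>nat\<close> below never truncate when \<open>xs \<in> tuples d\<close>.
  The value at dimension 0 is a dummy.\<close>

fun rs :: "nat \<Rightarrow> nat list \<Rightarrow> nat" where
  "rs 0 xs = 0"
| "rs (Suc 0) xs = hd xs"
| "rs (Suc (Suc n)) xs =
    (let d = Suc (Suc n); m = Max (set xs); x = last xs
     in rs (d - 1) (butlast xs) + m ^ d + (m - x) * ((m + 1) ^ (d - 1) - m ^ (d - 1)))"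

text \<open>The inverse formula is evaluated over the integers, so that no subtraction truncates:
  that it stays within the natural numbers is part of what has to be proved about it.
  The value at dimension 0 is a dummy.\<close>

fun rs_inv :: "nat \<Rightarrow> int \<Rightarrow> int list" where
  "rs_inv 0 z = []"
| "rs_inv (Suc 0) z = [z]"
| "rs_inv (Suc (Suc n)) z =
    (let d = Suc (Suc n);
         m = \<lfloor>root d (real_of_int z)\<rfloor>;
         x = m - \<lfloor>real_of_int (max 0 (z - m ^ d - m ^ (d - 1)))
                    / real_of_int ((m + 1) ^ (d - 1) - m ^ (d - 1))\<rfloor>
     in rs_inv (d - 1) (z - m ^ d - (m - x) * ((m + 1) ^ (d - 1) - m ^ (d - 1))) @ [x])"

end

theory Submission
  imports Defs
begin

text \<open>Write \<open>D = (m + 1)^(d-1) - m^(d-1)\<close>. By induction on \<open>d\<close>, the function \<open>r\<^sub>d\<close> maps the shell of tuples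
  with maximum \<open>m\<close> into \<open>[m^d, (m+1)^d)\<close>, so \<open>m\<close> is recovered as an integer root. The last component
  is then a quotient by \<open>D\<close>: if \<open>(x\<^sub>1, \<dots>, x\<^sub>d\<^sub>-\<^sub>1)\<close> has maximum \<open>m\<close>, its code is \<open>m^(d-1)\<close> plus a
  remainder below \<open>D\<close>; otherwise \<open>x\<^sub>d = m\<close>, its code is below \<open>m^(d-1)\<close>, and the truncation
  \<open>max 0\<close> makes the quotient \<open>0\<close>. Surjectivity follows by running this decoding, since
  \<open>(m+1)^d - m^d - m^(d-1) = (m + 1) D\<close> bounds the quotient by \<open>m\<close>.\<close>

text \<open>Puts the recursion in the form used for induction: splitting off the last entry leaves
  \<open>ys\<close> free for the induction hypothesis.\<close>

lemma rs_snoc: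
  assumes "length ys = n" "n > 0" "m = max (Max (set ys)) x"
  shows "rs (Suc n) (ys @ [x]) = rs n ys + m ^ Suc n + (m - x) * ((m + 1) ^ n - m ^ n)"
proof -
  obtain k where n: "n = Suc k" using assms(2) by (cases n) auto
  have "ys \<noteq> []" using assms by auto
  then have "Max (set (ys @ [x])) = m"
    using assms(3) by (simp add: max.commute)
  then show ?thesis unfolding n by (simp only: rs.simps Let_def butlast_snoc last_snoc diff_Suc_1)
qed

text \<open>For positive \<open>d\<close>, \<open>root d\<close> is strictly increasing, so
  consecutive powers around \<open>z\<close> fix the floor. This evaluates the real root in
  \<open>rs_inv\<close>.\<close>

lemma floor_root_eq:
  assumes "d > 0" "m ^ d \<le> z" "z < (m + 1) ^ d"
  shows "\<lfloor>root d (real z)\<rfloor> = int m"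
proof -
  have "real m ^ d \<le> real z" "real z < real (m + 1) ^ d"
    using assms(2,3) by (metis of_nat_le_iff of_nat_power, metis of_nat_less_iff of_nat_power)
  then have "root d (real m ^ d) \<le> root d (real z)" "root d (real z) < root d (real (m + 1) ^ d)"
    using assms(1) by (auto simp del: of_nat_add)
  then show ?thesis
    using assms(1) by (simp add: real_root_power_cancel floor_eq_iff)
qed

lemma ex_root_bracket:
  fixes z :: nat
  assumes "d > 0"
  obtains m where "m ^ d \<le> z" "z < (m + 1) ^ d"
proof -
  have z: "z < (z + 1) ^ d"
    using self_le_power[of "z + 1" d] assms by linarith
  \<comment> \<open>By minimality the predecessor of \<open>m\<close> fails the test, which is the
    lower bound; for \<open>m = 0\<close> that bound is \<open>0 ^ d = 0\<close>.\<close>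
  define m where "m = (LEAST m. z < (m + 1) ^ d)"
  have up: "z < (m + 1) ^ d" unfolding m_def by (rule LeastI, rule z)
  have "m ^ d \<le> z"
  proof (cases m)
    case 0
    then show ?thesis using assms by (simp add: power_0_left)
  next
    case (Suc k)
    then have "\<not> z < (k + 1) ^ d"
      using not_less_Least[of k "\<lambda>m. z < (m + 1) ^ d"] by (simp add: m_def)
    then show ?thesis using Suc by simp
  qed
  with up show thesis using that by blast
qed

text \<open>Makes \<open>D\<close> positive, hence usable as a divisor, and the natural subtraction
  defining it exact.\<close>

lemma power_shell_pos: "n > 0 \<Longrightarrow> (m::nat) ^ n < (m + 1) ^ n"
  by (simp add: power_strict_mono)

lemma rs_bounds:
  assumes "d > 0" "length xs = d"
  shows "Max (set xs) ^ d \<le> rs d xs \<and> rs d xs < (Max (set xs) + 1) ^ d"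
  using assms
proof (induction d arbitrary: xs rule: nat_induct_non_zero)
  case 1
  then show ?case by (cases xs) auto
next
  case (Suc n)
  obtain ys x where xs: "xs = ys @ [x]" and len: "length ys = n"
    using Suc.prems by (metis length_Suc_conv_rev)
  define m where "m = max (Max (set ys)) x"
  have "ys \<noteq> []" using len Suc.hyps by auto
  then have M: "Max (set xs) = m"
    by (simp add: xs m_def max.commute)
  define D where "D = (m + 1) ^ n - m ^ n"
  have D: "(m + 1) ^ n = m ^ n + D"
    using power_shell_pos[OF Suc.hyps, of m] by (simp add: D_def)
  have r: "rs (Suc n) xs = rs n ys + m ^ Suc n + (m - x) * D"
    using rs_snoc[OF len Suc.hyps m_def] by (simp add: xs D_def)
  have "rs n ys < (Max (set ys) + 1) ^ n" using Suc.IH[OF len] by simp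
  also have "\<dots> \<le> (m + 1) ^ n" by (rule power_mono) (auto simp: m_def)
  finally have "rs n ys < m ^ n + D" by (simp only: D)
  moreover have "(m - x) * D \<le> m * D" by (rule mult_right_mono) auto
  \<comment> \<open>Expanding \<open>(m + 1) * (m ^ n + D)\<close> gives exactly the sum of the
    upper bounds on the three summands of the code.\<close>
  moreover have "(m + 1) ^ Suc n = m ^ n + D + m ^ Suc n + m * D"
    using D by (simp add: algebra_simps)
  ultimately have "rs (Suc n) xs < (m + 1) ^ Suc n" using r by linarith
  moreover have "m ^ Suc n \<le> rs (Suc n) xs" using r by linarith
  ultimately show ?case using M by simp
qed

text \<open>One decoding step undoes one encoding step: it splits off \<open>x\<close> and passes
  the code of \<open>ys\<close> on to dimension \<open>n\<close>.\<close>

lemma rs_inv_snoc: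
  assumes "length ys = n" "n > 0"
  shows "rs_inv (Suc n) (int (rs (Suc n) (ys @ [x]))) = rs_inv n (int (rs n ys)) @ [int x]"
proof -
  define m where "m = max (Max (set ys)) x"
  define z where "z = rs (Suc n) (ys @ [x])"
  define D where "D = (int m + 1) ^ n - int m ^ n"
  have x: "x \<le> m" by (simp add: m_def)
  have lt: "m ^ n < (m + 1) ^ n" by (rule power_shell_pos[OF assms(2)])
  have D': "int ((m + 1) ^ n - m ^ n) = D"
    using lt by (simp add: D_def of_nat_diff add.commute)
  then have Dpos: "D > 0" using lt by linarith
  have z: "int z = int (rs n ys) + int m ^ Suc n + (int m - int x) * D"
    using rs_snoc[OF assms m_def] x D'
    by (simp add: z_def of_nat_diff del: power_Suc)
  have "ys \<noteq> []" using assms by auto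
  then have "Max (set (ys @ [x])) = m"
    by (simp add: m_def max.commute)
  then have "m ^ Suc n \<le> z" "z < (m + 1) ^ Suc n"
    using rs_bounds[of "Suc n" "ys @ [x]"] assms(1) unfolding z_def by auto
  then have root: "\<lfloor>root (Suc n) (real_of_int (int z))\<rfloor> = int m"
    using floor_root_eq[of "Suc n" m z] by simp
  have ybounds: "Max (set ys) ^ n \<le> rs n ys" "rs n ys < (Max (set ys) + 1) ^ n"
    using rs_bounds[OF assms(2,1)] by auto
  \<comment> \<open>The floor of the real quotient in \<open>rs_inv\<close> equals this integer
    \<open>div\<close>.\<close>
  have quot: "max 0 (int z - int m ^ Suc n - int m ^ n) div D = int m - int x"
  proof (cases "Max (set ys) = m")
    case True
    have "int m ^ n \<le> int (rs n ys)"
      using ybounds(1) True by (metis of_nat_le_iff of_nat_power)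
    moreover have "int (rs n ys) < (int m + 1) ^ n"
      using ybounds(2) True by (metis of_nat_less_iff of_nat_power of_nat_add of_nat_1)
    ultimately have e: "0 \<le> int (rs n ys) - int m ^ n" "int (rs n ys) - int m ^ n < D"
      by (auto simp: D_def)
    have "int z - int m ^ Suc n - int m ^ n
        = (int (rs n ys) - int m ^ n) + (int m - int x) * D"
      using z by simp
    moreover have "0 \<le> (int m - int x) * D" using x Dpos by simp
    ultimately have "max 0 (int z - int m ^ Suc n - int m ^ n)
        = (int (rs n ys) - int m ^ n) + (int m - int x) * D"
      using e(1) by linarith
    moreover have "((int (rs n ys) - int m ^ n) + (int m - int x) * D) div D = int m - int x"
      using e Dpos by (subst div_mult_self1) (auto simp: div_pos_pos_trivial)
    ultimately show ?thesis by simp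
  next
    case False
    then have mx: "x = m" and "Max (set ys) + 1 \<le> m"
      by (auto simp: m_def max_def split: if_splits)
    then have "rs n ys < m ^ n"
      using ybounds(2) power_mono[of "Max (set ys) + 1" m n] by linarith
    then have "int (rs n ys) < int m ^ n" by (metis of_nat_less_iff of_nat_power)
    then show ?thesis using z mx by simp
  qed
  \<comment> \<open>The recursive clause of \<open>rs_inv\<close> needs the form
    \<open>Suc (Suc k)\<close>. The nested differences below are its last component with the value
    from \<open>quot\<close> inserted.\<close>
  obtain k where n: "n = Suc k" using assms(2) by (cases n) auto
  have "rs_inv (Suc n) (int z)
      = rs_inv n (int z - int m ^ Suc n - (int m - (int m - (int m - int x))) * D)
        @ [int m - (int m - int x)]"
    using root quot unfolding n D_def
    by (simp only: rs_inv.simps Let_def diff_Suc_1 floor_divide_of_int_eq)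
  also have "int z - int m ^ Suc n - (int m - (int m - (int m - int x))) * D = int (rs n ys)"
    using z by simp
  finally show ?thesis by (simp add: z_def)
qed

text \<open>This left inverse yields the injectivity of \<open>rs d\<close> and, once surjectivity
  is known, the formula for its inverse.\<close>

lemma rs_inv_rs:
  assumes "d > 0" "length xs = d"
  shows "rs_inv d (int (rs d xs)) = map int xs"
  using assms
proof (induction d arbitrary: xs rule: nat_induct_non_zero)
  case 1
  then show ?case by (cases xs) auto
next
  case (Suc n)
  obtain ys x where "xs = ys @ [x]" "length ys = n"
    using Suc.prems by (metis length_Suc_conv_rev)
  then show ?case
    using rs_inv_snoc[of ys n x] Suc.IH[of ys] Suc.hyps by simp
qed

lemma rs_surj:
  assumes "d > 0"
  shows "\<exists>xs. length xs = d \<and> rs d xs = z"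
  using assms
proof (induction d arbitrary: z rule: nat_induct_non_zero)
  case 1
  show ?case by (rule exI[of _ "[z]"]) simp
next
  case (Suc n)
  obtain m where m: "m ^ Suc n \<le> z" "z < (m + 1) ^ Suc n"
    using ex_root_bracket[of "Suc n" z] by blast
  define D where "D = (m + 1) ^ n - m ^ n"
  have lt: "m ^ n < (m + 1) ^ n" by (rule power_shell_pos[OF Suc.hyps])
  then have D: "(m + 1) ^ n = m ^ n + D" and Dpos: "D > 0"
    by (auto simp: D_def)
  define w where "w = z - m ^ Suc n"
  have z: "z = w + m ^ Suc n" using m(1) by (simp add: w_def)
  show ?case
  proof (cases "w < m ^ n")
    case True
    obtain ys where ys: "length ys = n" "rs n ys = w" using Suc.IH by blast
    have "Max (set ys) ^ n \<le> w"
      using rs_bounds[OF Suc.hyps ys(1)] ys(2) by simp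
    then have "Max (set ys) ^ n < m ^ n" using True by simp
    then have "Max (set ys) < m" by (rule power_less_imp_less_base) simp
    then have "m = max (Max (set ys)) m" by simp
    from rs_snoc[OF ys(1) Suc.hyps this] have "rs (Suc n) (ys @ [m]) = z"
      using ys(2) z by simp
    then show ?thesis using ys(1) by (intro exI[of _ "ys @ [m]"]) simp
  next
    case False
    \<comment> \<open>\<open>k\<close> is to be \<open>m - x\<close> for the last component
      \<open>x\<close>, and \<open>v\<close> the code of the other components.\<close>
    define k where "k = (w - m ^ n) div D"
    define v where "v = m ^ n + (w - m ^ n) mod D"
    have w: "w = v + k * D"
      using False div_mult_mod_eq[of "w - m ^ n" D] unfolding k_def v_def by linarith
    have "(m + 1) ^ Suc n = m ^ n + m ^ Suc n + (m + 1) * D"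
      using D by (simp add: algebra_simps)
    \<comment> \<open>This forces \<open>k < m + 1\<close>, so the witness \<open>m - k\<close>
      below does not truncate.\<close>
    then have "w - m ^ n < (m + 1) * D" using m(2) z False by linarith
    then have k: "k \<le> m"
      unfolding k_def using less_mult_imp_div_less[of "w - m ^ n" "m + 1" D] by simp
    obtain ys where ys: "length ys = n" "rs n ys = v" using Suc.IH by blast
    \<comment> \<open>A code in this range can only come from a tuple with maximum exactly
      \<open>m\<close>, by comparing the two shells.\<close>
    have "v < (m + 1) ^ n" "m ^ n \<le> v" using D Dpos by (auto simp: v_def)
    then have "Max (set ys) ^ n < (m + 1) ^ n" "m ^ n < (Max (set ys) + 1) ^ n"
      using rs_bounds[OF Suc.hyps ys(1)] ys(2) by auto
    then have "Max (set ys) < m + 1" "m < Max (set ys) + 1"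
      by (auto intro: power_less_imp_less_base)
    then have "m = max (Max (set ys)) (m - k)" by simp
    from rs_snoc[OF ys(1) Suc.hyps this] have "rs (Suc n) (ys @ [m - k]) = z"
      using ys(2) z w k by (simp add: D_def)
    then show ?thesis using ys(1) by (intro exI[of _ "ys @ [m - k]"]) simp
  qed
qed

theorem theorem17:
  fixes d :: nat
  assumes "d > 0"
  shows "tupling_function d (rs d) \<and>
    (\<forall>z :: nat. rs_inv d (int z) = map int (inv_into (tuples d) (rs d) z))"
proof -
  have "inj_on (rs d) (tuples d)"
  proof (rule inj_onI)
    fix xs ys
    assume "xs \<in> tuples d" "ys \<in> tuples d" "rs d xs = rs d ys"
    then have "map int xs = map int ys"
      using rs_inv_rs[OF assms] by (metis mem_Collect_eq tuples_def)
    then show "xs = ys" by (simp add: inj_map_eq_map)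
  qed
  moreover have surj: "rs d ` tuples d = UNIV"
  proof (rule UNIV_eq_I[symmetric])
    fix z
    show "z \<in> rs d ` tuples d" using rs_surj[OF assms, of z] by (auto simp: tuples_def)
  qed
  ultimately have "tupling_function d (rs d)"
    by (simp add: tupling_function_def bij_betw_def)
  moreover have "rs_inv d (int z) = map int (inv_into (tuples d) (rs d) z)" for z
  proof -
    \<comment> \<open>Surjectivity writes \<open>z\<close> as the code of a tuple, on which the left
      inverse can be evaluated.\<close>
    have "inv_into (tuples d) (rs d) z \<in> tuples d" "rs d (inv_into (tuples d) (rs d) z) = z"
      using surj by (auto intro: inv_into_into f_inv_into_f)
    then show ?thesis using rs_inv_rs[OF assms] by (metis mem_Collect_eq tuples_def)
  qed
  ultimately show ?thesis by blast
qed

end
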